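(* Suppose that for every edge $(i,j)\in\mathcal{E}$ the dissipation function $f_{ij}(u,v)$ is strictly increasing in its second argument $v$, and that for every edge the following unique solvability property holds: for all admissible $x_c\in[0,L_{ij}]$, $\rho_0\ge 0$ and $\phi_0\in\mathbb{R}$ there exists a unique trajectory $\rho(x)$, $x\in[0,L_{ij}]$, with $\rho(x_c)=\rho_0$ and $f_{ij}(\rho(x),\partial_x\rho(x))+\phi_0=0$. Consider two sets of flow injections $(q_i^{(1)})_{i\in\mathcal{V}}$ and $(q_i^{(2)})_{i\in\mathcal{V}}$ associated with nodal densities $(\rho_i^{(1)})_{i\in\mathcal{V}}$ and $(\rho_i^{(2)})_{i\in\mathcal{V}}$ respectively (together with edge densities $\rho_{ij}^{(k)}$ and edge flows $\phi_{ij}^{(k)}$, $k=1,2$), each satisfying the steady-state network flow system. Let $\mathcal{S}\subseteq\mathcal{V}$ be an arbitrary subset such that $q_i^{(1)}\ge q_i^{(2)}$ for all $i\in\mathcal{S}$ and $\rho_i^{(1)}\ge\rho_i^{(2)}$ for all $i\in\mathcal{V}\setminus\mathcal{S}$. Then $\rho_i^{(1)}\ge\rho_i^{(2)}$ for all $i\in\mathcal{V}$, and $\rho_{ij}^{(1)}(x_{ij})\ge\rho_{ij}^{(2)}(x_{ij})$ for all $x_{ij}\in[0,L_{ij}]$ and all $(i,j)\in\mathcal{E}$.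
   Context: Let $(\mathcal{V},\mathcal{E},\lambda)$ be a finite metric graph with vertex set $\mathcal{V}$, directed edges $\mathcal{E}\subset\mathcal{V}\times\mathcal{V}$ and edge lengths $L_{ij}=\lambda(i,j)>0$. For $j\in\mathcal{V}$ let $\partial_+j=\{i\in\mathcal{V}: (i,j)\in\mathcal{E}\}$ and $\partial_-j=\{k\in\mathcal{V}: (j,k)\in\mathcal{E}\}$. $\mathbb{R}_+$ denotes the non-negative reals. Each edge $(i,j)$ carries a constant flow $\phi_{ij}\in\mathbb{R}$ and a density $\rho_{ij}:[0,L_{ij}]\to\mathbb{R}_+$; each vertex $i$ has an internal nodal density $\rho_i\in\mathbb{R}_+$ and a flow injection $q_i\in\mathbb{R}$. Write $\underline{\rho}_{ij}=\rho_{ij}(0)$ and $\overline{\rho}_{ij}=\rho_{ij}(L_{ij})$. The steady-state network flow system is $$\phi_{ij}+f_{ij}(\rho_{ij}(x_{ij}),\partial_x\rho_{ij}(x_{ij}))=0\quad\text{for all }(i,j)\in\mathcal{E},\ x_{ij}\in[0,L_{ij}],$$ $$q_j+\sum_{i\in\partial_+j}\phi_{ij}-\sum_{k\in\partial_-j}\phi_{jk}=0\quad\text{for all }j\in\mathcal{V},$$ $$\underline{\rho}_{ij}=\underline{\alpha}_{ij}(\rho_i),\qquad \overline{\rho}_{ij}=\overline{\alpha}_{ij}(\rho_j)\quad\text{for all }(i,j)\in\mathcal{E}.$$ Here $f_{ij}:\mathbb{R}_+\times\mathbb{R}\to\mathbb{R}$ are given dissipation functions, and $\underline{\alpha}_{ij},\overline{\alpha}_{ij}$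 are given strictly increasing compatibility functions. The same functions $f_{ij},\underline{\alpha}_{ij},\overline{\alpha}_{ij}$ are used in both scenarios.
   Formalization: It is additionally assumed that every connected component of the graph has a vertex outside S (for a connected graph: S ≠ V); with S = V the claim fails, e.g. f(u,v)=v, identity compatibility functions, zero flows and injections, constant densities 1 and 2. *)

theory Defs
  imports "HOL-Analysis.Analysis"
begin

definition metric_graph :: "'v set \<Rightarrow> ('v \<times> 'v) set \<Rightarrow> ('v \<Rightarrow> 'v \<Rightarrow> real) \<Rightarrow> bool" where
  "metric_graph V E L \<longleftrightarrow> finite V \<and> E \<subseteq> V \<times> V \<and> (\<forall>(i, j) \<in> E. 0 < L i j)"

definition nbrs_in :: "'v set \<Rightarrow> ('v \<times> 'v) set \<Rightarrow> 'v \<Rightarrow> 'v set" where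
  "nbrs_in V E j = {i \<in> V. (i, j) \<in> E}"

definition nbrs_out :: "'v set \<Rightarrow> ('v \<times> 'v) set \<Rightarrow> 'v \<Rightarrow> 'v set" where
  "nbrs_out V E j = {k \<in> V. (j, k) \<in> E}"

(* Densities are total functions on the reals of which only the values on {0..l} matter.  The
   derivative is taken within {0..l}, hence one-sided at the two end points. *)
definition trajectory ::
  "(real \<Rightarrow> real \<Rightarrow> real) \<Rightarrow> real \<Rightarrow> real \<Rightarrow> (real \<Rightarrow> real) \<Rightarrow> bool" where
  "trajectory f l \<phi> \<rho> \<longleftrightarrow>
     (\<forall>x \<in> {0..l}. 0 \<le> \<rho> x \<and>
        (\<exists>d. (\<rho> has_real_derivative d) (at x within {0..l}) \<and> f (\<rho> x) d + \<phi> = 0))"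

(* Data (xc, r0, p0) are admissible if some non-negative trajectory on the whole edge has them.
   Not all xc in {0..l}, r0 \<ge> 0 and p0 can be admissible: a trajectory vanishing at an interior
   point has a minimum there, so its derivative is 0 and p0 = - f 0 0 is forced. *)
definition admissible ::
  "(real \<Rightarrow> real \<Rightarrow> real) \<Rightarrow> real \<Rightarrow> real \<Rightarrow> real \<Rightarrow> real \<Rightarrow> bool" where
  "admissible f l xc r0 p0 \<longleftrightarrow>
     xc \<in> {0..l} \<and> 0 \<le> r0 \<and> (\<exists>\<rho>. trajectory f l p0 \<rho> \<and> \<rho> xc = r0)"

(* Uniqueness is equality on {0..l}.  By the choice of admissible data the existence part is
   automatic; the condition is implied by unique existence on any larger set of data. *)
definition uniquely_solvable :: "(real \<Rightarrow> real \<Rightarrow> real) \<Rightarrow> real \<Rightarrow> bool" where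
  "uniquely_solvable f l \<longleftrightarrow>
     (\<forall>xc r0 p0. admissible f l xc r0 p0 \<longrightarrow>
        (\<exists>\<rho>. trajectory f l p0 \<rho> \<and> \<rho> xc = r0 \<and>
           (\<forall>\<sigma>. trajectory f l p0 \<sigma> \<and> \<sigma> xc = r0 \<longrightarrow> (\<forall>x \<in> {0..l}. \<sigma> x = \<rho> x))))"

(* Here q are the injections, \<phi> the edge flows, r the nodal and \<rho> the edge densities; \<alpha> and \<beta>
   are the compatibility functions at the tail (x = 0) and at the head (x = L i j) of an edge. *)
definition steady_state ::
  "'v set \<Rightarrow> ('v \<times> 'v) set \<Rightarrow> ('v \<Rightarrow> 'v \<Rightarrow> real) \<Rightarrow> ('v \<Rightarrow> 'v \<Rightarrow> real \<Rightarrow> real \<Rightarrow> real) \<Rightarrow>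
   ('v \<Rightarrow> 'v \<Rightarrow> real \<Rightarrow> real) \<Rightarrow> ('v \<Rightarrow> 'v \<Rightarrow> real \<Rightarrow> real) \<Rightarrow>
   ('v \<Rightarrow> real) \<Rightarrow> ('v \<Rightarrow> 'v \<Rightarrow> real) \<Rightarrow> ('v \<Rightarrow> real) \<Rightarrow> ('v \<Rightarrow> 'v \<Rightarrow> real \<Rightarrow> real) \<Rightarrow> bool" where
  "steady_state V E L f \<alpha> \<beta> q \<phi> r \<rho> \<longleftrightarrow>
     (\<forall>i \<in> V. 0 \<le> r i) \<and>
     (\<forall>(i, j) \<in> E. trajectory (f i j) (L i j) (\<phi> i j) (\<rho> i j)) \<and>
     (\<forall>j \<in> V. q j + (\<Sum>i \<in> nbrs_in V E j. \<phi> i j) - (\<Sum>k \<in> nbrs_out V E j. \<phi> j k) = 0) \<and>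
     (\<forall>(i, j) \<in> E. \<rho> i j 0 = \<alpha> i j (r i) \<and> \<rho> i j (L i j) = \<beta> i j (r j))"

(* Every connected component of the underlying undirected graph has a vertex outside S; for a
   connected graph this means S \<noteq> V.  Without this condition nodal densities on a component
   contained in S need not be comparable: on an isolated vertex they are unconstrained. *)
definition every_component_leaves :: "'v set \<Rightarrow> ('v \<times> 'v) set \<Rightarrow> 'v set \<Rightarrow> bool" where
  "every_component_leaves V E S \<longleftrightarrow> (\<forall>i \<in> V. \<exists>j \<in> V - S. (i, j) \<in> (E \<union> E\<inverse>)\<^sup>*)"

end

theory Submission imports Defs begin

text \<open>
  On one edge, where the two densities meet, strict monotonicity of \<open>f\<close> in its second argument makes
  the density with the larger flow have the smaller slope. So the density with the larger flow, once
  smaller, stays smaller downstream; for equal flows, meeting densities coincide by uniqueness.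
  Let \<open>B\<close> be the set of vertices where the first nodal density is strictly smaller; it lies in \<open>S\<close>.
  The edge comparison shows that the flow difference is strictly negative on edges leaving \<open>B\<close> and
  strictly positive on edges entering \<open>B\<close>, while summing the balance equations over \<open>B\<close> gives
  a non-negative net outflow difference. So no edge joins \<open>B\<close> to its complement, and since every
  component leaves \<open>S\<close>, \<open>B\<close> is empty.
\<close>

lemma trajectory_continuous_on:
  assumes "trajectory f l p \<rho>"
  shows "continuous_on {0..l} \<rho>"
  using assms unfolding trajectory_def
  by (meson DERIV_continuous continuous_on_eq_continuous_within)

text \<open>The trajectory \<open>b\<close> itself witnesses that its value at \<open>x\<close> is
  admissible data, so \<open>a\<close> and \<open>b\<close> both agree on \<open>{0..l}\<close> with
  the one solution that these data determine.\<close>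

lemma uniquely_solvable_meet:
  assumes "uniquely_solvable f l" "trajectory f l p a" "trajectory f l p b"
    and "x \<in> {0..l}" "y \<in> {0..l}" "a x = b x"
  shows "a y = b y"
proof -
  have "admissible f l x (b x) p"
    using assms unfolding admissible_def trajectory_def by blast
  then obtain \<rho> where "\<forall>\<sigma>. trajectory f l p \<sigma> \<and> \<sigma> x = b x \<longrightarrow> (\<forall>x \<in> {0..l}. \<sigma> x = \<rho> x)"
    using assms(1) unfolding uniquely_solvable_def by blast
  then show ?thesis using assms by metis
qed

text \<open>At a common value both equations involve the same function \<open>f (a z)\<close>, which
  takes the value \<open>- p\<close> at one slope and the larger value \<open>- p'\<close> at the
  other. The derivative is taken within \<open>{0..l}\<close>, so that \<open>z\<close> may be an
  end point.\<close>

lemma trajectory_slope_less: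
  assumes mono: "\<And>u. 0 \<le> u \<Longrightarrow> strict_mono (f u)"
    and "trajectory f l p a" "trajectory f l p' b"
    and "p' < p" "z \<in> {0..l}" "a z = b z"
  obtains d where "0 < d" "((\<lambda>x. b x - a x) has_real_derivative d) (at z within {0..l})"
proof -
  obtain d1 where d1: "(a has_real_derivative d1) (at z within {0..l})" "f (a z) d1 + p = 0"
    and "0 \<le> a z"
    using assms unfolding trajectory_def by blast
  obtain d2 where d2: "(b has_real_derivative d2) (at z within {0..l})" "f (b z) d2 + p' = 0"
    using assms unfolding trajectory_def by blast
  have "f (a z) d1 < f (a z) d2" using d1 d2 assms by simp
  then have "d1 < d2" using mono[OF \<open>0 \<le> a z\<close>] by (simp add: strict_mono_less)
  with that[of "d2 - d1"] DERIV_diff[OF d2(1) d1(1)] show thesis by simp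
qed

text \<open>Otherwise the two curves meet, and the contradiction arises at their first meeting point
  after \<open>x\<close>: for equal flows from uniqueness, for \<open>p' < p\<close> from the order
  of the slopes there.\<close>

lemma trajectory_less_downstream:
  assumes mono: "\<And>u. 0 \<le> u \<Longrightarrow> strict_mono (f u)"
    and us: "uniquely_solvable f l"
    and a: "trajectory f l p a" and b: "trajectory f l p' b"
    and "p' \<le> p" "0 \<le> x" "x \<le> y" "y \<le> l" "a x < b x"
  shows "a y < b y"
proof (rule ccontr)
  assume "\<not> a y < b y"
  define Z where "Z = {x..y} \<inter> (\<lambda>t. a t - b t) -` {0}"
  have cont: "continuous_on {x..y} (\<lambda>t. a t - b t)"
    by (rule continuous_on_subset[of "{0..l}"])
      (use assms in \<open>auto intro!: continuous_intros dest: trajectory_continuous_on\<close>)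
  then have "closed Z" unfolding Z_def by (intro continuous_closed_preimage) auto
  moreover have "Z \<noteq> {}"
    using IVT'[of "\<lambda>t. a t - b t" x 0 y] cont \<open>\<not> a y < b y\<close> assms by (auto simp: Z_def)
  moreover have bdd: "bdd_below Z" by (auto simp: Z_def)
  \<comment> \<open>Closedness makes the infimum an actual meeting point, hence the first
    one.\<close>
  ultimately have "Inf Z \<in> Z" by (simp add: closed_contains_Inf)
  define z where "z = Inf Z"
  have z: "z \<in> {x..y}" "a z = b z" using \<open>Inf Z \<in> Z\<close> by (auto simp: Z_def z_def)
  have "x < z" using z assms by (cases "x = z") auto
  \<comment> \<open>A failure at \<open>t\<close> would, by the intermediate value theorem, produce
    a meeting point before \<open>z\<close>.\<close>
  have less: "a t < b t" if "t \<in> {x..<z}" for t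
  proof (rule ccontr)
    assume "\<not> a t < b t"
    moreover have "continuous_on {x..t} (\<lambda>t. a t - b t)"
      using cont by (rule continuous_on_subset) (use that z in auto)
    ultimately have "\<exists>s\<ge>x. s \<le> t \<and> a s - b s = 0"
      using that assms by (intro IVT') auto
    then obtain s where "s \<in> {x..t}" "a s = b s" by auto
    then have "s \<in> Z" using that z by (auto simp: Z_def)
    then have "z \<le> s" unfolding z_def using bdd by (rule cInf_lower)
    then show False using \<open>s \<in> {x..t}\<close> that by auto
  qed
  show False
  proof (cases "p' = p")
    case True
    then have "a x = b x"
      using uniquely_solvable_meet[OF us, of p a b z x] assms z by auto
    then show False using assms by simp
  next
    case False
    \<comment> \<open>The difference \<open>b - a\<close> vanishes at \<open>z\<close> with positive
      slope, so it is negative just to the left of \<open>z\<close>, against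
      \<open>less\<close>.\<close>
    then obtain d where "0 < d" "((\<lambda>x. b x - a x) has_real_derivative d) (at z within {0..l})"
      using trajectory_slope_less[OF mono a b, of z] assms z by auto
    from has_real_derivative_pos_inc_left[OF this(2,1)] obtain e where
      "e > 0" and e: "\<And>h. \<lbrakk>0 < h; z - h \<in> {0..l}; h < e\<rbrakk> \<Longrightarrow> b (z - h) - a (z - h) < b z - a z"
      by blast
    \<comment> \<open>The bound \<open>e / 2\<close> keeps \<open>h\<close> below \<open>e\<close>,
      and \<open>z - x\<close> keeps \<open>z - h\<close> from passing to the left of
      \<open>x\<close>.\<close>
    define h where "h = min (e / 2) (z - x)"
    have "0 < h" "h < e" "z - h \<in> {x..<z}" using \<open>e > 0\<close> \<open>x < z\<close> by (auto simp: h_def)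
    with e[of h] less[of "z - h"] z assms show False by auto
  qed
qed

text \<open>No second search for a meeting point is needed: the downstream lemma with the two
  trajectories exchanged excludes \<open>b t < a t\<close> anywhere on \<open>{0..x}\<close>. A
  failure at \<open>y\<close> is then an equality, and for \<open>p < p'\<close> the slopes at
  \<open>y\<close> force \<open>b\<close> below \<open>a\<close> just to the right of it.\<close>

lemma trajectory_less_upstream:
  assumes mono: "\<And>u. 0 \<le> u \<Longrightarrow> strict_mono (f u)"
    and us: "uniquely_solvable f l"
    and a: "trajectory f l p a" and b: "trajectory f l p' b"
    and "p \<le> p'" "0 \<le> y" "y \<le> x" "x \<le> l" "a x < b x"
  shows "a y < b y"
proof (rule ccontr)
  assume "\<not> a y < b y"
  have stay: "\<not> b t < a t" if "0 \<le> t" "t \<le> x" for t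
    using trajectory_less_downstream[OF mono us b a, of t x] assms that by auto
  with \<open>\<not> a y < b y\<close> have "b y = a y" using assms by force
  show False
  proof (cases "p' = p")
    case True
    then have "a x = b x"
      using uniquely_solvable_meet[OF us, of p a b y x] assms \<open>b y = a y\<close> by auto
    then show False using assms by simp
  next
    case False
    have "y < x" using assms \<open>b y = a y\<close> by (cases "y = x") auto
    obtain d where "0 < d" "((\<lambda>x. a x - b x) has_real_derivative d) (at y within {0..l})"
      using trajectory_slope_less[OF mono b a, of y] assms False \<open>b y = a y\<close> by auto
    from has_real_derivative_pos_inc_right[OF this(2,1)] obtain e where
      "e > 0" and e: "\<And>h. \<lbrakk>0 < h; y + h \<in> {0..l}; h < e\<rbrakk> \<Longrightarrow> a y - b y < a (y + h) - b (y + h)"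
      by blast
    define h where "h = min (e / 2) (x - y)"
    have "0 < h" "h < e" "y + h \<le> x" using \<open>e > 0\<close> \<open>y < x\<close> by (auto simp: h_def)
    with e[of h] stay[of "y + h"] assms \<open>b y = a y\<close> show False by auto
  qed
qed

text \<open>Discrete divergence theorem: an edge with both ends in \<open>B\<close>, loops included,
  is counted once as outgoing and once as incoming, and cancels.\<close>

lemma sum_divergence_eq_boundary:
  fixes g :: "'v \<Rightarrow> 'v \<Rightarrow> real"
  assumes "finite V" "E \<subseteq> V \<times> V" "B \<subseteq> V"
  shows "(\<Sum>j\<in>B. (\<Sum>k\<in>nbrs_out V E j. g j k) - (\<Sum>i\<in>nbrs_in V E j. g i j)) =
    (\<Sum>(j, k)\<in>{(j, k) \<in> E. j \<in> B \<and> k \<notin> B}. g j k) -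
    (\<Sum>(i, j)\<in>{(i, j) \<in> E. i \<notin> B \<and> j \<in> B}. g i j)"
proof -
  have "finite B" "finite E"
    using assms finite_subset[of E "V \<times> V"] finite_subset[of B V] by auto
  let ?int = "{(j, k) \<in> E. j \<in> B \<and> k \<in> B}"
  let ?out = "{(j, k) \<in> E. j \<in> B \<and> k \<notin> B}"
  let ?in = "{(i, j) \<in> E. i \<notin> B \<and> j \<in> B}"
  have "(\<Sum>j\<in>B. \<Sum>k\<in>nbrs_out V E j. g j k) = (\<Sum>(j, k)\<in>Sigma B (nbrs_out V E). g j k)"
    using \<open>finite B\<close> assms(1) by (subst sum.Sigma) (auto simp: nbrs_out_def)
  also have "Sigma B (nbrs_out V E) = ?int \<union> ?out"
    using assms by (auto simp: nbrs_out_def)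
  also have "(\<Sum>(j, k)\<in>?int \<union> ?out. g j k) = (\<Sum>(j, k)\<in>?int. g j k) + (\<Sum>(j, k)\<in>?out. g j k)"
    by (intro sum.union_disjoint) (auto intro: finite_subset[OF _ \<open>finite E\<close>])
  finally have 1: "(\<Sum>j\<in>B. \<Sum>k\<in>nbrs_out V E j. g j k) = \<dots>" .
  have "(\<Sum>j\<in>B. \<Sum>i\<in>nbrs_in V E j. g i j) = (\<Sum>(j, i)\<in>Sigma B (nbrs_in V E). g i j)"
    using \<open>finite B\<close> assms(1) by (subst sum.Sigma) (auto simp: nbrs_in_def)
  also have "\<dots> = (\<Sum>(i, j)\<in>?int \<union> ?in. g i j)"
    \<comment> \<open>The \<open>Sigma\<close> set lists the head of an edge first, so its pairs are
      swapped to become elements of \<open>E\<close>.\<close>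
    by (rule sum.reindex_bij_witness[of _ prod.swap prod.swap])
      (use assms in \<open>auto simp: nbrs_in_def\<close>)
  also have "\<dots> = (\<Sum>(j, k)\<in>?int. g j k) + (\<Sum>(i, j)\<in>?in. g i j)"
    by (intro sum.union_disjoint) (auto intro: finite_subset[OF _ \<open>finite E\<close>])
  finally have 2: "(\<Sum>j\<in>B. \<Sum>i\<in>nbrs_in V E j. g i j) = \<dots>" .
  show ?thesis by (simp add: sum_subtractf 1 2)
qed

theorem theorem1:
  fixes V :: "'v set" and E :: "('v \<times> 'v) set" and L :: "'v \<Rightarrow> 'v \<Rightarrow> real"
    and f :: "'v \<Rightarrow> 'v \<Rightarrow> real \<Rightarrow> real \<Rightarrow> real"
    and \<alpha> \<beta> :: "'v \<Rightarrow> 'v \<Rightarrow> real \<Rightarrow> real"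
    and q\<^sub>1 q\<^sub>2 r\<^sub>1 r\<^sub>2 :: "'v \<Rightarrow> real"
    and \<phi>\<^sub>1 \<phi>\<^sub>2 :: "'v \<Rightarrow> 'v \<Rightarrow> real"
    and \<rho>\<^sub>1 \<rho>\<^sub>2 :: "'v \<Rightarrow> 'v \<Rightarrow> real \<Rightarrow> real"
    and S :: "'v set"
  assumes "metric_graph V E L"
    and "\<And>i j. (i, j) \<in> E \<Longrightarrow> strict_mono_on {0..} (\<alpha> i j)"
    and "\<And>i j. (i, j) \<in> E \<Longrightarrow> strict_mono_on {0..} (\<beta> i j)"
    and "\<And>i j u. (i, j) \<in> E \<Longrightarrow> 0 \<le> u \<Longrightarrow> strict_mono (f i j u)"
    and "\<And>i j. (i, j) \<in> E \<Longrightarrow> uniquely_solvable (f i j) (L i j)"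
    and "steady_state V E L f \<alpha> \<beta> q\<^sub>1 \<phi>\<^sub>1 r\<^sub>1 \<rho>\<^sub>1"
    and "steady_state V E L f \<alpha> \<beta> q\<^sub>2 \<phi>\<^sub>2 r\<^sub>2 \<rho>\<^sub>2"
    and "S \<subseteq> V"
    and "every_component_leaves V E S"
    and "\<And>i. i \<in> S \<Longrightarrow> q\<^sub>1 i \<ge> q\<^sub>2 i"
    and "\<And>i. i \<in> V - S \<Longrightarrow> r\<^sub>1 i \<ge> r\<^sub>2 i"
  shows "(\<forall>i \<in> V. r\<^sub>1 i \<ge> r\<^sub>2 i) \<and>
         (\<forall>(i, j) \<in> E. \<forall>x \<in> {0..L i j}. \<rho>\<^sub>1 i j x \<ge> \<rho>\<^sub>2 i j x)"
proof -
  note mono_\<alpha> = assms(2) and mono_\<beta> = assms(3) and mono_f = assms(4) and solv = assms(5)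
  have fin: "finite V" and E: "E \<subseteq> V \<times> V" and L: "\<And>i j. (i, j) \<in> E \<Longrightarrow> 0 < L i j"
    using assms(1) by (auto simp: metric_graph_def)
  have traj: "trajectory (f i j) (L i j) (\<phi>\<^sub>1 i j) (\<rho>\<^sub>1 i j)"
    "trajectory (f i j) (L i j) (\<phi>\<^sub>2 i j) (\<rho>\<^sub>2 i j)" if "(i, j) \<in> E" for i j
    using assms(6,7) that by (auto simp: steady_state_def)
  have r: "0 \<le> r\<^sub>1 i" "0 \<le> r\<^sub>2 i" if "i \<in> V" for i
    using assms(6,7) that by (auto simp: steady_state_def)
  have ends: "\<rho>\<^sub>1 i j 0 = \<alpha> i j (r\<^sub>1 i)" "\<rho>\<^sub>1 i j (L i j) = \<beta> i j (r\<^sub>1 j)"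
    "\<rho>\<^sub>2 i j 0 = \<alpha> i j (r\<^sub>2 i)" "\<rho>\<^sub>2 i j (L i j) = \<beta> i j (r\<^sub>2 j)" if "(i, j) \<in> E" for i j
    using assms(6,7) that by (auto simp: steady_state_def)
  have tail: "\<rho>\<^sub>1 i j 0 < \<rho>\<^sub>2 i j 0 \<longleftrightarrow> r\<^sub>1 i < r\<^sub>2 i" if "(i, j) \<in> E" for i j
    using ends[OF that] strict_mono_on_less[OF mono_\<alpha>[OF that]] r E that by auto
  have head: "\<rho>\<^sub>1 i j (L i j) < \<rho>\<^sub>2 i j (L i j) \<longleftrightarrow> r\<^sub>1 j < r\<^sub>2 j" if "(i, j) \<in> E" for i j
    using ends[OF that] strict_mono_on_less[OF mono_\<beta>[OF that]] r E that by auto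
  \<comment> \<open>The point \<open>x\<close> is arbitrary because \<open>down\<close> and
    \<open>up\<close> serve twice: at an end point for the sign of the flow difference on boundary
    edges, and at any point for the final comparison of edge densities.\<close>
  have down: "r\<^sub>1 j < r\<^sub>2 j"
    if "(i, j) \<in> E" "\<phi>\<^sub>2 i j \<le> \<phi>\<^sub>1 i j" "x \<in> {0..L i j}" "\<rho>\<^sub>1 i j x < \<rho>\<^sub>2 i j x" for i j x
    using trajectory_less_downstream[OF mono_f solv traj, of i j x "L i j"] that head by auto
  have up: "r\<^sub>1 i < r\<^sub>2 i"
    if "(i, j) \<in> E" "\<phi>\<^sub>1 i j \<le> \<phi>\<^sub>2 i j" "x \<in> {0..L i j}" "\<rho>\<^sub>1 i j x < \<rho>\<^sub>2 i j x" for i j x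
    using trajectory_less_upstream[OF mono_f solv traj, of i j 0 x] that tail by auto
  define g where "g = (\<lambda>i j. \<phi>\<^sub>1 i j - \<phi>\<^sub>2 i j)"
  define B where "B = {i \<in> V. r\<^sub>1 i < r\<^sub>2 i}"
  define Out where "Out = {(j, k) \<in> E. j \<in> B \<and> k \<notin> B}"
  define In where "In = {(i, j) \<in> E. i \<notin> B \<and> j \<in> B}"
  have "B \<subseteq> S" using assms(11) by (force simp: B_def)
  have "finite E" using fin E finite_subset[of E "V \<times> V"] by auto
  have "finite Out" "finite In"
    using \<open>finite E\<close> by (auto simp: Out_def In_def intro: finite_subset[of _ E])
  \<comment> \<open>If \<open>g j k\<close> were non-negative, \<open>down\<close> applied at the
    tail would put \<open>k\<close> into \<open>B\<close>. In \<open>pos\<close> below,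
    \<open>up\<close> applied at the head plays the same part.\<close>
  have neg: "g j k < 0" if "(j, k) \<in> Out" for j k
  proof -
    from that have "(j, k) \<in> E" "r\<^sub>1 j < r\<^sub>2 j" "\<not> r\<^sub>1 k < r\<^sub>2 k"
      using E by (auto simp: Out_def B_def)
    then show ?thesis using down[of j k 0] tail[of j k] L[of j k] unfolding g_def by fastforce
  qed
  have pos: "0 < g i j" if "(i, j) \<in> In" for i j
  proof -
    from that have "(i, j) \<in> E" "\<not> r\<^sub>1 i < r\<^sub>2 i" "r\<^sub>1 j < r\<^sub>2 j"
      using E by (auto simp: In_def B_def)
    then show ?thesis using up[of i j "L i j"] head[of i j] L[of i j] unfolding g_def by fastforce
  qed
  \<comment> \<open>By the balance equations this difference equals
    \<open>q\<^sub>1 j - q\<^sub>2 j\<close>, and the injections are ordered on \<open>S\<close>,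
    which contains \<open>B\<close>.\<close>
  have "0 \<le> (\<Sum>k\<in>nbrs_out V E j. g j k) - (\<Sum>i\<in>nbrs_in V E j. g i j)" if "j \<in> B" for j
  proof -
    have "q\<^sub>2 j \<le> q\<^sub>1 j" "j \<in> V" using that \<open>B \<subseteq> S\<close> assms(8,10) by auto
    then have "q\<^sub>1 j + (\<Sum>i\<in>nbrs_in V E j. \<phi>\<^sub>1 i j) - (\<Sum>k\<in>nbrs_out V E j. \<phi>\<^sub>1 j k) = 0"
      "q\<^sub>2 j + (\<Sum>i\<in>nbrs_in V E j. \<phi>\<^sub>2 i j) - (\<Sum>k\<in>nbrs_out V E j. \<phi>\<^sub>2 j k) = 0"
      using assms(6,7) unfolding steady_state_def by blast+
    then show ?thesis using \<open>q\<^sub>2 j \<le> q\<^sub>1 j\<close> by (simp add: g_def sum_subtractf)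
  qed
  then have "0 \<le> (\<Sum>j\<in>B. (\<Sum>k\<in>nbrs_out V E j. g j k) - (\<Sum>i\<in>nbrs_in V E j. g i j))"
    by (rule sum_nonneg)
  then have balance: "(\<Sum>(i, j)\<in>In. g i j) \<le> (\<Sum>(j, k)\<in>Out. g j k)"
    using sum_divergence_eq_boundary[OF fin E, of B g] by (simp add: B_def Out_def In_def)
  have "Out = {}"
  proof (rule ccontr)
    assume "Out \<noteq> {}"
    then have "(\<Sum>(j, k)\<in>Out. g j k) < (\<Sum>_\<in>Out. 0)"
      using neg \<open>finite Out\<close> by (intro sum_strict_mono) auto
    moreover have "0 \<le> (\<Sum>(i, j)\<in>In. g i j)" using pos by (force intro: sum_nonneg)
    ultimately show False using balance by simp
  qed
  have "In = {}"
  proof (rule ccontr)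
    assume "In \<noteq> {}"
    then have "(\<Sum>_\<in>In. 0) < (\<Sum>(i, j)\<in>In. g i j)"
      using pos \<open>finite In\<close> by (intro sum_strict_mono) auto
    then show False using balance \<open>Out = {}\<close> by simp
  qed
  \<comment> \<open>No edge crosses the boundary of \<open>B\<close> in either direction, so
    undirected paths cannot leave \<open>B\<close>.\<close>
  have closed: "j \<in> B" if "(i, j) \<in> (E \<union> E\<inverse>)\<^sup>*" "i \<in> B" for i j
    using that
    by (induction rule: rtrancl_induct) (use \<open>Out = {}\<close> \<open>In = {}\<close> in \<open>auto simp: Out_def In_def\<close>)
  have "B = {}"
  proof (rule ccontr)
    assume "B \<noteq> {}"
    then obtain i where "i \<in> B" by blast
    then obtain j where "j \<in> V - S" "(i, j) \<in> (E \<union> E\<inverse>)\<^sup>*"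
      using assms(9) by (auto simp: every_component_leaves_def B_def)
    then show False using closed \<open>i \<in> B\<close> \<open>B \<subseteq> S\<close> by blast
  qed
  then have nodal: "r\<^sub>2 i \<le> r\<^sub>1 i" if "i \<in> V" for i
    using that by (auto simp: B_def not_less)
  moreover have "\<rho>\<^sub>2 i j x \<le> \<rho>\<^sub>1 i j x" if "(i, j) \<in> E" "x \<in> {0..L i j}" for i j x
  proof (rule ccontr)
    assume "\<not> \<rho>\<^sub>2 i j x \<le> \<rho>\<^sub>1 i j x"
    \<comment> \<open>The two flows on the edge are comparable, so \<open>up\<close> or
      \<open>down\<close> carries the deficit at \<open>x\<close> to one of the end
      vertices.\<close>
    then have "r\<^sub>1 i < r\<^sub>2 i \<or> r\<^sub>1 j < r\<^sub>2 j"
      using up[OF that(1) _ that(2)] down[OF that(1) _ that(2)] by linarith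
    then show False using nodal[of i] nodal[of j] that(1) E by auto
  qed
  ultimately show ?thesis by auto
qed

end
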